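(* For each sequence $(c_n)_{n\ge 0}$ in $X$, the generalized Hardy inequality corresponding to $(c_n)$ is equivalent to the generalized Hilbert inequality corresponding to $(c_n)$; that is, the following are equivalent: (i) there is a constant $A\ge 0$ such that for every $f(z)=\sum_{n=0}^{\infty} a_n z^n$ in $H^1$, $$\sum_{n=0}^{\infty} |a_n c_n| \le A\, \|(c_n)\|\, \|f\|_1 ;$$ (ii) there is a constant $B\ge 0$ such that for all $(a_n), (b_n)$ in $\ell^2_+$, $$\sum_{n,m=0}^{\infty} |a_n|\,|b_m|\,|c_{n+m}| \le B\, \|(c_n)\|\, \|(a_n)\|_2\, \|(b_n)\|_2 .$$ Moreover, the least constant $A\ge 0$ for which the inequality in (i) holds for all $f\in H^1$ is equal to the least constant $B\ge 0$ for which the inequality in (ii) holds for all $(a_n),(b_n)\in\ell^2_+$.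
   Context: $X$ denotes the space of (complex) sequences $(c_n)_{n\ge 0}$ such that $$\|(c_n)\|^2 = \sup\left\{ \frac{\sum_{k=0}^n (k+1)^2 |c_k|^2}{n+1} : n\in\mathbb{N}\right\} < \infty ,$$ and $\|(c_n)\|$ is the norm on $X$ so defined. $H^1$ is the Hardy space of holomorphic functions $f$ on the open unit disk $\mathbb{D}$ with $$\|f\|_1=\sup_{0<r<1} \frac{1}{2\pi}\int_0^{2\pi} |f(re^{i\theta})|\, d\theta<\infty .$$ This is the same as the subspace of $L^1$ of the unit circle (normalized arc length measure) of functions whose negative Fourier coefficients vanish, with its $L^1$ norm. $\ell^2_+$ is the Hilbert space of square-summable complex sequences indexed by the integers $n\ge 0$, with norm $\|(a_n)\|_2=\left(\sum_{n\ge 0}|a_n|^2\right)^{1/2}$. *)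

theory Defs
  imports "HOL-Analysis.Analysis"
begin

definition X_ratio :: "(nat \<Rightarrow> complex) \<Rightarrow> nat \<Rightarrow> real" where
  "X_ratio c n = (\<Sum>k=0..n. (real k + 1)\<^sup>2 * (cmod (c k))\<^sup>2) / (real n + 1)"

definition X_space :: "(nat \<Rightarrow> complex) set" where
  "X_space = {c. bdd_above (range (X_ratio c))}"

definition X_norm :: "(nat \<Rightarrow> complex) \<Rightarrow> real" where
  "X_norm c = sqrt (SUP n. X_ratio c n)"

definition circle_mean :: "(complex \<Rightarrow> complex) \<Rightarrow> real \<Rightarrow> real" where
  "circle_mean f r = 1 / (2 * pi) * integral {0..2 * pi} (\<lambda>\<theta>. cmod (f (of_real r * cis \<theta>)))"

text \<open>
  Elements are total functions; their values outside the open unit disk play no role.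
\<close>
definition H1 :: "(complex \<Rightarrow> complex) set" where
  "H1 = {f. f holomorphic_on ball 0 1 \<and> bdd_above (circle_mean f ` {0<..<1})}"

definition H1_norm :: "(complex \<Rightarrow> complex) \<Rightarrow> real" where
  "H1_norm f = (SUP r\<in>{0<..<1}. circle_mean f r)"

definition l2 :: "(nat \<Rightarrow> complex) set" where
  "l2 = {a. summable (\<lambda>n. (cmod (a n))\<^sup>2)}"

definition l2_norm :: "(nat \<Rightarrow> complex) \<Rightarrow> real" where
  "l2_norm a = sqrt (\<Sum>n. (cmod (a n))\<^sup>2)"

text \<open>
  Infinite sums of reals have a default value when they diverge, so in the two inequalities
  below convergence of the nonnegative left-hand side is stated explicitly.
\<close>
definition hardy_inequality :: "(nat \<Rightarrow> complex) \<Rightarrow> real \<Rightarrow> bool" where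
  "hardy_inequality c A \<longleftrightarrow>
     (\<forall>f\<in>H1. \<forall>a. (\<forall>z\<in>ball 0 1. (\<lambda>n. a n * z ^ n) sums f z) \<longrightarrow>
        summable (\<lambda>n. cmod (a n * c n)) \<and>
        (\<Sum>n. cmod (a n * c n)) \<le> A * X_norm c * H1_norm f)"

definition hilbert_inequality :: "(nat \<Rightarrow> complex) \<Rightarrow> real \<Rightarrow> bool" where
  "hilbert_inequality c B \<longleftrightarrow>
     (\<forall>a\<in>l2. \<forall>b\<in>l2.
        (\<lambda>(n, m). cmod (a n) * cmod (b m) * cmod (c (n + m))) summable_on UNIV \<and>
        infsum (\<lambda>(n, m). cmod (a n) * cmod (b m) * cmod (c (n + m))) UNIV
          \<le> B * X_norm c * l2_norm a * l2_norm b)"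

definition is_least_constant :: "(real \<Rightarrow> bool) \<Rightarrow> real \<Rightarrow> bool" where
  "is_least_constant P K \<longleftrightarrow> 0 \<le> K \<and> P K \<and> (\<forall>C\<ge>0. P C \<longrightarrow> K \<le> C)"

end

theory Submission
  imports Defs "HOL-Complex_Analysis.Laurent_Convergence"
begin

text \<open>
  For a fixed \<open>C \<ge> 0\<close>, Hardy's inequality holds with constant \<open>C\<close> if and only if Hilbert's inequality
  does; hence the two sets of admissible constants agree, and so do their least elements. The
  link is the correspondence between \<open>H\<^sup>1\<close> functions and products \<open>g h\<close> of two \<open>H\<^sup>2\<close> functions.

  If \<open>g\<close> and \<open>h\<close> have coefficients \<open>\<bar>a\<^sub>k\<bar>\<close> and \<open>\<bar>b\<^sub>m\<bar>\<close>, then \<open>g h\<close> has the Cauchy product as its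
  coefficients, and testing Hardy's inequality on it gives exactly the double sum in Hilbert's
  inequality. The Cauchy--Schwarz inequality on circles and Parseval's identity yield
  \<open>\<parallel>g h\<parallel>\<^sub>1 \<le> \<parallel>a\<parallel>\<^sub>2 \<parallel>b\<parallel>\<^sub>2\<close> (lemma \<open>hardy_imp_hilbert\<close>).

  Conversely, \<open>f \<in> H\<^sup>1\<close> has to be written as \<open>g h\<close> with \<open>\<parallel>g\<parallel>\<^sub>2\<^sup>2\<close> and \<open>\<parallel>h\<parallel>\<^sub>2\<^sup>2\<close> at most \<open>\<parallel>f\<parallel>\<^sub>1\<close>. Instead of
  Riesz's factorization with an infinite Blaschke product it suffices to treat polynomials, and
  to approximate the dilations \<open>f (r z)\<close> by their Taylor polynomials. For a polynomial \<open>p\<close>, the zeros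
  in the disc are reflected one by one in the unit circle (lemma \<open>outer_polynomial\<close>). This gives a
  polynomial \<open>q\<close> without zeros in the disc such that \<open>\<bar>q\<bar> = \<bar>p\<bar>\<close> on the circle and \<open>\<bar>p\<bar> \<le> \<bar>q\<bar>\<close> inside.
  Then \<open>q = s\<^sup>2\<close> in the disc, and \<open>p = s (p / s)\<close> is the desired factorization, since \<open>\<bar>s\<bar>\<^sup>2 = \<bar>q\<bar>\<close> and
  \<open>\<bar>p / s\<bar>\<^sup>2 \<le> \<bar>q\<bar>\<close>. Hilbert's inequality, applied to the coefficients of both factors, bounds the
  sum of \<open>\<bar>p\<^sub>n c\<^sub>n\<bar>\<close> by a multiple of the mean of \<open>\<bar>p\<bar>\<close> over the circle (lemma \<open>hilbert_imp_polynomial_bound\<close>).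
\<close>

section \<open>Integral means over circles\<close>

lemma continuous_on_circle:
  assumes "continuous_on (sphere 0 r) f" "0 \<le> r"
  shows "continuous_on S (\<lambda>\<theta>. f (of_real r * cis \<theta>))"
  by (rule continuous_on_compose2[OF assms(1)])
     (auto intro!: continuous_intros simp: norm_mult assms)

lemma circle_mean_integrable:
  assumes "continuous_on (sphere 0 r) f" "0 \<le> r"
  shows "(\<lambda>\<theta>. cmod (f (of_real r * cis \<theta>))) integrable_on {0..2 * pi}"
  by (intro integrable_continuous_real continuous_on_norm continuous_on_circle assms)

lemma circle_mean_nonneg: "0 \<le> circle_mean f r"
  unfolding circle_mean_def
  by (cases "(\<lambda>\<theta>. cmod (f (of_real r * cis \<theta>))) integrable_on {0..2 * pi}")
     (auto intro!: divide_nonneg_nonneg integral_nonneg simp: not_integrable_integral)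

lemma circle_mean_mono:
  assumes "continuous_on (sphere 0 r) f" "continuous_on (sphere 0 r) g" "0 \<le> r"
    and "\<And>z. cmod z = r \<Longrightarrow> cmod (f z) \<le> cmod (g z)"
  shows "circle_mean f r \<le> circle_mean g r"
  unfolding circle_mean_def
  by (intro mult_left_mono integral_le circle_mean_integrable assms)
     (auto simp: norm_mult assms(3))

lemma circle_mean_cong:
  assumes "\<And>z. cmod z = r \<Longrightarrow> cmod (f z) = cmod (g z)" "0 \<le> r"
  shows "circle_mean f r = circle_mean g r"
  unfolding circle_mean_def using assms by (simp add: norm_mult)

lemma circle_mean_tendsto:
  assumes lim: "uniform_limit (sphere 0 r) F f sequentially"
    and cont: "\<And>n. continuous_on (sphere 0 r) (F n)" and r: "0 \<le> r"
  shows "(\<lambda>n. circle_mean (F n) r) \<longlonglongrightarrow> circle_mean f r"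
proof -
  have "uniform_limit {0..2 * pi} (\<lambda>n \<theta>. F n (of_real r * cis \<theta>)) (\<lambda>\<theta>. f (of_real r * cis \<theta>)) sequentially"
    by (rule uniform_limit_compose'[OF lim]) (auto simp: norm_mult r)
  then have "uniform_limit {0..2 * pi} (\<lambda>n \<theta>. cmod (F n (of_real r * cis \<theta>)))
               (\<lambda>\<theta>. cmod (f (of_real r * cis \<theta>))) sequentially"
    by (rule uniform_limit_norm)
  then obtain I J where I: "\<And>n. ((\<lambda>\<theta>. cmod (F n (of_real r * cis \<theta>))) has_integral I n) {0..2 * pi}"
    and J: "((\<lambda>\<theta>. cmod (f (of_real r * cis \<theta>))) has_integral J) {0..2 * pi}" and "I \<longlonglongrightarrow> J"
    by (rule uniform_limit_integral)
       (auto intro!: continuous_on_norm continuous_on_circle cont r)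
  then show ?thesis
    unfolding circle_mean_def integral_unique[OF I] integral_unique[OF J] by (intro tendsto_intros)
qed

lemma continuous_on_circle_mean:
  assumes "continuous_on UNIV f"
  shows "continuous_on UNIV (circle_mean f)"
proof -
  have "continuous_on UNIV (\<lambda>r. integral (cbox 0 (2 * pi)) (\<lambda>\<theta>. cmod (f (of_real r * cis \<theta>))))"
    by (rule integral_continuous_on_param)
       (auto simp: case_prod_unfold intro!: continuous_intros continuous_on_compose2[OF assms])
  then show ?thesis
    unfolding circle_mean_def by (auto intro!: continuous_intros)
qed

text \<open>
  The weighted inequality between the arithmetic and the geometric mean, integrated. The weight
  \<open>t\<close> is free so that it can be optimized afterwards.
\<close>
lemma circle_mean_mult_le:
  assumes g: "continuous_on (sphere 0 r) g" and h: "continuous_on (sphere 0 r) h"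
    and r: "0 \<le> r" and t: "0 < t"
  shows "circle_mean (\<lambda>z. g z * h z) r
    \<le> (t * circle_mean (\<lambda>z. (g z)\<^sup>2) r + circle_mean (\<lambda>z. (h z)\<^sup>2) r / t) / 2"
proof -
  let ?G = "\<lambda>\<theta>. cmod ((g (of_real r * cis \<theta>))\<^sup>2)" and ?H = "\<lambda>\<theta>. cmod ((h (of_real r * cis \<theta>))\<^sup>2)"
  have ig: "?G integrable_on {0..2 * pi}" and ih: "?H integrable_on {0..2 * pi}"
    using circle_mean_integrable[of r "\<lambda>z. (g z)\<^sup>2"] circle_mean_integrable[of r "\<lambda>z. (h z)\<^sup>2"]
    by (auto intro!: continuous_intros g h r)
  have ineq: "x * y \<le> (t * x\<^sup>2 + y\<^sup>2 / t) / 2" for x y :: real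
  proof -
    have "0 \<le> (t * x - y)\<^sup>2 / t" using t by simp
    also have "\<dots> = t * x\<^sup>2 + y\<^sup>2 / t - 2 * x * y" using t by (simp add: field_simps power2_eq_square)
    finally show ?thesis by simp
  qed
  have "integral {0..2 * pi} (\<lambda>\<theta>. cmod (g (of_real r * cis \<theta>) * h (of_real r * cis \<theta>)))
      \<le> integral {0..2 * pi} (\<lambda>\<theta>. (t * ?G \<theta> + ?H \<theta> / t) / 2)"
  proof (rule integral_le)
    show "(\<lambda>\<theta>. cmod (g (of_real r * cis \<theta>) * h (of_real r * cis \<theta>))) integrable_on {0..2 * pi}"
      using circle_mean_integrable[of r "\<lambda>z. g z * h z"] by (auto intro!: continuous_intros g h r)
    show "(\<lambda>\<theta>. (t * ?G \<theta> + ?H \<theta> / t) / 2) integrable_on {0..2 * pi}"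
      by (intro integrable_on_divide integrable_add integrable_on_mult_right ig ih)
  qed (use ineq in \<open>simp add: norm_mult norm_power\<close>)
  also have "\<dots> = (t * integral {0..2 * pi} ?G + integral {0..2 * pi} ?H / t) / 2"
    by (subst integral_divide, subst integral_add)
       (auto intro!: integrable_on_divide integrable_on_mult_right ig ih)
  finally show ?thesis
    unfolding circle_mean_def by (simp add: field_simps)
qed

text \<open>
  The optimal weight is \<open>v / u\<close>, where \<open>u\<close> and \<open>v\<close> are the two factors on the right. Either may
  vanish, so both are first enlarged by \<open>e > 0\<close>, which then tends to \<open>0\<close>.
\<close>
lemma circle_mean_Cauchy_Schwarz:
  assumes g: "continuous_on (sphere 0 r) g" and h: "continuous_on (sphere 0 r) h" and r: "0 \<le> r"
  shows "circle_mean (\<lambda>z. g z * h z) r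
    \<le> sqrt (circle_mean (\<lambda>z. (g z)\<^sup>2) r) * sqrt (circle_mean (\<lambda>z. (h z)\<^sup>2) r)"
proof -
  define u where "u = sqrt (circle_mean (\<lambda>z. (g z)\<^sup>2) r)"
  define v where "v = sqrt (circle_mean (\<lambda>z. (h z)\<^sup>2) r)"
  have u: "0 \<le> u" "circle_mean (\<lambda>z. (g z)\<^sup>2) r = u\<^sup>2" and v: "0 \<le> v" "circle_mean (\<lambda>z. (h z)\<^sup>2) r = v\<^sup>2"
    by (simp_all add: u_def v_def circle_mean_nonneg)
  have "circle_mean (\<lambda>z. g z * h z) r \<le> (u + e) * (v + e)" if e: "0 < e" for e
  proof -
    define t where "t = (v + e) / (u + e)"
    have t: "0 < t" using e u v by (simp add: t_def)
    have "circle_mean (\<lambda>z. g z * h z) r \<le> (t * u\<^sup>2 + v\<^sup>2 / t) / 2"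
      using circle_mean_mult_le[OF g h r t] unfolding u v .
    also have "\<dots> \<le> (t * (u + e)\<^sup>2 + (v + e)\<^sup>2 / t) / 2"
      using t e u v by (intro divide_right_mono add_mono mult_left_mono power_mono) auto
    also have "\<dots> = (u + e) * (v + e)"
    proof -
      have "(y / x * x\<^sup>2 + y\<^sup>2 / (y / x)) / 2 = x * y" if "x \<noteq> 0" "y \<noteq> 0" for x y :: real
        using that by (simp add: field_simps power2_eq_square)
      moreover have "u + e \<noteq> 0" "v + e \<noteq> 0" using e u v by linarith+
      ultimately show ?thesis unfolding t_def by blast
    qed
    finally show ?thesis .
  qed
  moreover have "((\<lambda>e. (u + e) * (v + e)) \<longlongrightarrow> (u + 0) * (v + 0)) (at_right 0)"
    by (intro tendsto_intros)
  ultimately have "circle_mean (\<lambda>z. g z * h z) r \<le> (u + 0) * (v + 0)"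
    by (intro tendsto_lowerbound[where F = "at_right 0"])
       (auto intro: eventually_mono[OF eventually_at_right_less])
  then show ?thesis by (simp add: u_def v_def)
qed

section \<open>Power series in the disc and Parseval's identity\<close>

lemma power_series_holomorphic_on_disc:
  fixes a :: "nat \<Rightarrow> complex"
  assumes "\<And>z. z \<in> ball 0 1 \<Longrightarrow> (\<lambda>n. a n * z ^ n) sums f z"
  shows "f holomorphic_on ball 0 1"
  by (rule power_series_holomorphic[of _ _ a]) (use assms in simp)

lemma power_series_unique:
  fixes a b :: "nat \<Rightarrow> complex"
  assumes "\<And>z. z \<in> ball 0 1 \<Longrightarrow> (\<lambda>n. a n * z ^ n) sums f z"
    and "\<And>z. z \<in> ball 0 1 \<Longrightarrow> (\<lambda>n. b n * z ^ n) sums f z"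
  shows "a = b"
proof -
  have near: "eventually (\<lambda>z. z \<in> ball 0 1) (nhds (0::complex))"
    by (intro eventually_nhds_in_open) auto
  have "f has_fps_expansion Abs_fps a" "f has_fps_expansion Abs_fps b"
    by (intro has_fps_expansionI eventually_mono[OF near]; use assms in simp)+
  then have "Abs_fps a = Abs_fps b" by (rule fps_expansion_unique_complex)
  then show ?thesis by (metis fps_nth_Abs_fps ext)
qed

lemma power_series_mult:
  fixes a b :: "nat \<Rightarrow> complex"
  assumes a: "\<And>z. z \<in> ball 0 1 \<Longrightarrow> (\<lambda>n. a n * z ^ n) sums g z"
    and b: "\<And>z. z \<in> ball 0 1 \<Longrightarrow> (\<lambda>n. b n * z ^ n) sums h z"
    and z: "z \<in> ball 0 1"
  shows "(\<lambda>n. (\<Sum>k\<le>n. a k * b (n - k)) * z ^ n) sums (g z * h z)"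
proof -
  obtain \<rho> where \<rho>: "cmod z < \<rho>" "\<rho> < 1" using dense[of "cmod z" 1] z by auto
  then have "0 \<le> \<rho>" using norm_ge_zero[of z] by linarith
  with \<rho> have in_ball: "of_real \<rho> \<in> ball (0::complex) 1" and less: "cmod z < cmod (of_real \<rho>)" by simp_all
  have "summable (\<lambda>n. cmod (a n * z ^ n))" "summable (\<lambda>n. cmod (b n * z ^ n))"
    by (rule powser_insidea[OF sums_summable[OF a[OF in_ball]] less]
             powser_insidea[OF sums_summable[OF b[OF in_ball]] less])+
  from Cauchy_product_sums[OF this]
  have "(\<lambda>n. \<Sum>k\<le>n. (a k * z ^ k) * (b (n - k) * z ^ (n - k))) sums (g z * h z)"
    using a[OF z] b[OF z] by (simp add: sums_iff)
  moreover have "(\<Sum>k\<le>n. (a k * z ^ k) * (b (n - k) * z ^ (n - k))) = (\<Sum>k\<le>n. a k * b (n - k)) * z ^ n" for n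
    unfolding sum_distrib_right
  proof (rule sum.cong)
    fix k assume "k \<in> {..n}"
    then have "z ^ n = z ^ k * z ^ (n - k)" by (simp flip: power_add)
    then show "(a k * z ^ k) * (b (n - k) * z ^ (n - k)) = a k * b (n - k) * z ^ n" by simp
  qed simp
  ultimately show ?thesis by simp
qed

lemma power_series_uniform_limit:
  fixes a :: "nat \<Rightarrow> complex"
  assumes ps: "\<And>z. z \<in> ball 0 1 \<Longrightarrow> (\<lambda>n. a n * z ^ n) sums f z" and r: "0 \<le> r" "r < 1"
  shows "uniform_limit (sphere 0 r) (\<lambda>N z. \<Sum>k<N. a k * z ^ k) f sequentially"
proof -
  \<comment> \<open>convergence at a larger radius gives absolute convergence at \<open>r\<close>\<close>
  obtain \<rho> where "r < \<rho>" "\<rho> < 1" using dense r by blast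
  then have "summable (\<lambda>n. cmod (a n * of_real r ^ n))"
    using ps[of "of_real \<rho>"] r by (intro powser_insidea[of a "of_real \<rho>"]) (auto simp: sums_iff)
  then have "uniform_limit (sphere 0 r) (\<lambda>N z. \<Sum>k<N. a k * z ^ k) (\<lambda>z. \<Sum>k. a k * z ^ k) sequentially"
    by (rule Weierstrass_m_test[rotated]) (auto simp: norm_mult norm_power r)
  then show ?thesis
    by (rule uniform_limit_cong'[THEN iffD1, rotated -1])
       (use ps r in \<open>auto simp: sums_iff\<close>)
qed

lemma circle_mean_partial_sums:
  fixes a :: "nat \<Rightarrow> complex"
  assumes "\<And>z. z \<in> ball 0 1 \<Longrightarrow> (\<lambda>n. a n * z ^ n) sums f z" "0 \<le> r" "r < 1"
  shows "(\<lambda>N. circle_mean (\<lambda>z. \<Sum>k<N. a k * z ^ k) r) \<longlonglongrightarrow> circle_mean f r"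
  by (intro circle_mean_tendsto power_series_uniform_limit assms continuous_intros)

lemma has_integral_cis_int:
  fixes m :: int
  shows "((\<lambda>\<theta>. cis (of_int m * \<theta>)) has_integral (if m = 0 then of_real (2 * pi) else 0)) {0..2 * pi}"
proof (cases "m = 0")
  case True
  then show ?thesis
    using has_integral_const_real[of "1::complex" 0 "2 * pi"] by (simp add: scaleR_conv_of_real)
next
  case False
  define F where "F = (\<lambda>\<theta>. cis (of_int m * \<theta>) / (\<i> * of_int m))"
  have "((\<lambda>\<theta>. cis (of_int m * \<theta>)) has_integral (F (2 * pi) - F 0)) {0..2 * pi}"
  proof (rule fundamental_theorem_of_calculus)
    fix x :: real
    show "(F has_vector_derivative cis (of_int m * x)) (at x within {0..2 * pi})"
      unfolding F_def cis_conv_exp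
      by (rule has_vector_derivative_eq_rhs,
          (rule derivative_intros has_vector_derivative_real_field | simp)+)
         (use False in \<open>auto intro!: derivative_eq_intros simp: field_simps\<close>)
  qed simp
  moreover have "cis (of_int m * (2 * pi)) = 1"
    using cis_multiple_2pi[of "of_int m"] by (simp add: mult_ac)
  ultimately show ?thesis
    using False by (simp add: F_def)
qed

text \<open>
  Orthogonality of the exponentials on the circle: expanding \<open>\<bar>P\<bar>\<^sup>2 = P * cnj P\<close> into a double sum,
  only the diagonal survives integration. The mean of \<open>\<bar>P\<bar>\<^sup>2\<close> appears as the mean of \<open>\<bar>P\<^sup>2\<bar>\<close>.
\<close>
lemma circle_mean_square_sum:
  fixes a :: "nat \<Rightarrow> complex"
  shows "circle_mean (\<lambda>z. (\<Sum>k<N. a k * z ^ k)\<^sup>2) r = (\<Sum>k<N. (cmod (a k) * r ^ k)\<^sup>2)"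
proof -
  define w where "w k = a k * of_real (r ^ k)" for k
  let ?P = "\<lambda>\<theta>. \<Sum>k<N. a k * (of_real r * cis \<theta>) ^ k"
  have P: "?P \<theta> = (\<Sum>k<N. w k * cis (real k * \<theta>))" for \<theta>
    by (simp add: w_def power_mult_distrib Complex.DeMoivre mult_ac)
  have norm: "complex_of_real (cmod ((?P \<theta>)\<^sup>2))
      = (\<Sum>j<N. \<Sum>k<N. w j * cnj (w k) * cis (of_int (int j - int k) * \<theta>))" for \<theta>
  proof -
    have "complex_of_real (cmod ((?P \<theta>)\<^sup>2)) = ?P \<theta> * cnj (?P \<theta>)"
      by (simp add: norm_power complex_norm_square flip: of_real_power)
    also have "\<dots> = (\<Sum>j<N. \<Sum>k<N. (w j * cis (real j * \<theta>)) * cnj (w k * cis (real k * \<theta>)))"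
      by (simp only: P cnj_sum sum_product)
    also have "\<dots> = (\<Sum>j<N. \<Sum>k<N. w j * cnj (w k) * cis (of_int (int j - int k) * \<theta>))"
    proof (intro sum.cong refl)
      fix j k
      have "cis (of_int (int j - int k) * \<theta>) = cis (real j * \<theta>) * cnj (cis (real k * \<theta>))"
        by (simp add: cis_cnj cis_mult left_diff_distrib)
      then show "(w j * cis (real j * \<theta>)) * cnj (w k * cis (real k * \<theta>))
          = w j * cnj (w k) * cis (of_int (int j - int k) * \<theta>)"
        by (simp only: complex_cnj_mult mult_ac)
    qed
    finally show ?thesis .
  qed
  have "((\<lambda>\<theta>. complex_of_real (cmod ((?P \<theta>)\<^sup>2))) has_integral
      (\<Sum>j<N. \<Sum>k<N. w j * cnj (w k) * (if int j - int k = 0 then of_real (2 * pi) else 0))) {0..2 * pi}"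
    unfolding norm
    by (intro has_integral_sum has_integral_mult_right has_integral_cis_int finite_lessThan)
  also have "(\<Sum>j<N. \<Sum>k<N. w j * cnj (w k) * (if int j - int k = 0 then of_real (2 * pi) else 0))
      = of_real (2 * pi * (\<Sum>k<N. (cmod (w k))\<^sup>2))"
    by (simp add: if_distrib[of "\<lambda>x. _ * x"] complex_norm_square sum_distrib_left mult_ac
        flip: of_real_power cong: if_cong)
  finally have "((\<lambda>\<theta>. complex_of_real (cmod ((?P \<theta>)\<^sup>2))) has_integral
      of_real (2 * pi * (\<Sum>k<N. (cmod (w k))\<^sup>2))) {0..2 * pi}" .
  from has_integral_linear[OF this bounded_linear_Re]
  have "((\<lambda>\<theta>. cmod ((?P \<theta>)\<^sup>2)) has_integral 2 * pi * (\<Sum>k<N. (cmod (w k))\<^sup>2)) {0..2 * pi}"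
    by (simp only: o_def Re_complex_of_real)
  then show ?thesis
    unfolding circle_mean_def by (simp add: integral_unique w_def norm_mult norm_power power_mult_distrib flip: power_abs)
qed

text \<open>
  On a circle of radius less than \<open>1\<close> the partial sums converge uniformly to a bounded function, so
  their squares do as well, and the identity for partial sums passes to the limit.
\<close>
lemma parseval_circle:
  fixes a :: "nat \<Rightarrow> complex"
  assumes ps: "\<And>z. z \<in> ball 0 1 \<Longrightarrow> (\<lambda>n. a n * z ^ n) sums g z" and r: "0 \<le> r" "r < 1"
  shows "(\<lambda>n. (cmod (a n) * r ^ n)\<^sup>2) sums circle_mean (\<lambda>z. (g z)\<^sup>2) r"
proof -
  have cont: "continuous_on (sphere 0 r) g"
    by (rule uniform_limit_theorem[OF _ power_series_uniform_limit[of a]])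
       (use ps r in \<open>auto intro!: always_eventually continuous_intros\<close>)
  then have bdd: "bounded (g ` sphere 0 r)"
    by (intro compact_imp_bounded compact_continuous_image) auto
  note ul = power_series_uniform_limit[of a g r, OF ps r]
  have "uniform_limit (sphere 0 r) (\<lambda>N z. (\<Sum>k<N. a k * z ^ k) * (\<Sum>k<N. a k * z ^ k)) (\<lambda>z. g z * g z) sequentially"
    by (rule uniform_lim_mult[OF ul ul bdd bdd])
  then have "(\<lambda>N. circle_mean (\<lambda>z. (\<Sum>k<N. a k * z ^ k)\<^sup>2) r) \<longlonglongrightarrow> circle_mean (\<lambda>z. (g z)\<^sup>2) r"
    unfolding power2_eq_square by (rule circle_mean_tendsto) (intro continuous_intros r)+
  then show ?thesis
    unfolding circle_mean_square_sum sums_def .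
qed

section \<open>Square-summable sequences and the triangular form of Hilbert's inequality\<close>

lemma X_norm_nonneg:
  assumes "c \<in> X_space"
  shows "0 \<le> X_norm c"
proof -
  have "0 \<le> X_ratio c 0" by (simp add: X_ratio_def)
  also have "\<dots> \<le> (SUP n. X_ratio c n)"
    using assms by (intro cSUP_upper) (auto simp: X_space_def)
  finally show ?thesis by (simp add: X_norm_def)
qed

lemma l2_norm_nonneg: "a \<in> l2 \<Longrightarrow> 0 \<le> l2_norm a"
  by (simp add: l2_norm_def l2_def suminf_nonneg)

text \<open>
  A square-summable sequence is bounded, so its power series is dominated by a geometric series.
\<close>
lemma l2_power_series:
  assumes a: "a \<in> l2" and z: "z \<in> ball 0 1"
  shows "(\<lambda>n. a n * z ^ n) sums (\<Sum>n. a n * z ^ n)"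
proof -
  have "(\<lambda>n. (cmod (a n))\<^sup>2) \<longlonglongrightarrow> 0" using a by (intro summable_LIMSEQ_zero) (simp add: l2_def)
  then have "(\<lambda>n. sqrt ((cmod (a n))\<^sup>2)) \<longlonglongrightarrow> sqrt 0" by (intro tendsto_intros)
  then have "a \<longlonglongrightarrow> 0" by (simp add: tendsto_norm_zero_iff)
  then have "Bseq a" by (intro convergent_imp_Bseq) (auto simp: convergent_def)
  then obtain M where M: "\<And>n. cmod (a n) \<le> M" unfolding Bseq_def by blast
  have "summable (\<lambda>n. a n * z ^ n)"
  proof (rule summable_comparison_test'[of "\<lambda>n. M * cmod z ^ n" 0])
    show "summable (\<lambda>n. M * cmod z ^ n)" using z by (intro summable_mult summable_geometric) auto
  qed (auto simp: norm_mult norm_power intro!: mult_right_mono M)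
  then show ?thesis by (rule summable_sums)
qed

lemma circle_mean_square_le_l2_norm:
  assumes a: "a \<in> l2" and ps: "\<And>z. z \<in> ball 0 1 \<Longrightarrow> (\<lambda>n. a n * z ^ n) sums g z"
    and r: "0 \<le> r" "r < 1"
  shows "sqrt (circle_mean (\<lambda>z. (g z)\<^sup>2) r) \<le> l2_norm a"
proof -
  note P = parseval_circle[of a g r, OF ps r]
  have "circle_mean (\<lambda>z. (g z)\<^sup>2) r = (\<Sum>n. (cmod (a n) * r ^ n)\<^sup>2)"
    using P by (simp add: sums_iff)
  also have "\<dots> \<le> (\<Sum>n. (cmod (a n))\<^sup>2)"
    using P a r by (intro suminf_le power_mono) (auto simp: sums_iff l2_def power_le_one mult_left_le)
  finally show ?thesis by (simp add: l2_norm_def)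
qed

text \<open>
  All terms are nonnegative and the triangles \<open>n + m \<le> N\<close> exhaust the index set, so both summability
  and the bound on the sum are captured by the triangular partial sums. Grouping these along the
  antidiagonals exhibits the Cauchy product of \<open>\<bar>a\<bar>\<close> and \<open>\<bar>b\<bar>\<close>, which is how products of power series enter.
\<close>
lemma hilbert_inequality_iff_triangles:
  "hilbert_inequality c B \<longleftrightarrow> (\<forall>a\<in>l2. \<forall>b\<in>l2. \<forall>N.
     (\<Sum>n\<le>N. (\<Sum>k\<le>n. cmod (a k) * cmod (b (n - k))) * cmod (c n)) \<le> B * X_norm c * l2_norm a * l2_norm b)"
proof -
  have *: "((F summable_on UNIV) \<and> infsum F UNIV \<le> K) \<longleftrightarrow> (\<forall>N. (\<Sum>n\<le>N. (\<Sum>k\<le>n. cmod (a k) * cmod (b (n - k))) * cmod (c n)) \<le> K)"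
    if F: "F = (\<lambda>(n, m). cmod (a n) * cmod (b m) * cmod (c (n + m)))" for F a b K
  proof -
    define T where "T N = {(i, j). i + j \<le> (N::nat)}" for N
    have finT: "finite (T N)" for N
      by (rule finite_subset[of _ "{..N} \<times> {..N}"]) (auto simp: T_def)
    have F0: "F x \<ge> 0" for x by (auto simp: F case_prod_unfold)
    have T: "sum F (T N) = (\<Sum>n\<le>N. (\<Sum>k\<le>n. cmod (a k) * cmod (b (n - k))) * cmod (c n))" for N
      unfolding F T_def sum.triangle_reindex_eq by (intro sum.cong refl) (simp add: sum_distrib_right)
    have "F summable_on UNIV \<and> infsum F UNIV \<le> K \<longleftrightarrow> (\<forall>N. sum F (T N) \<le> K)"
    proof safe
      fix N assume "F summable_on UNIV" "infsum F UNIV \<le> K"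
      then show "sum F (T N) \<le> K"
        using finite_sum_le_infsum[of F UNIV "T N"] finT F0 by force
    next
      assume K: "\<forall>N. sum F (T N) \<le> K"
      have le_K: "sum F S \<le> K" if "finite S" for S
      proof -
        have "finite ((\<lambda>x. fst x + snd x) ` S)" using that by simp
        then obtain N where N: "\<And>x. x \<in> S \<Longrightarrow> fst x + snd x \<le> N"
          unfolding finite_nat_set_iff_bounded_le by auto
        then have "S \<subseteq> T N" by (force simp: T_def)
        then have "sum F S \<le> sum F (T N)" by (intro sum_mono2 finT F0)
        with K show ?thesis by (meson order_trans)
      qed
      show s: "F summable_on UNIV"
        by (rule nonneg_bdd_above_summable_on) (auto intro!: F0 bdd_aboveI[of _ K] le_K)
      show "infsum F UNIV \<le> K" by (rule infsum_le_finite_sums[OF s]) (rule le_K)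
    qed
    then show ?thesis by (simp only: T)
  qed
  show ?thesis unfolding hilbert_inequality_def *[OF refl] by (rule refl)
qed

section \<open>Hardy's inequality implies Hilbert's\<close>

text \<open>
  Hardy's inequality is applied to the product of the power series with coefficients \<open>\<bar>a\<^sub>k\<bar>\<close> and
  \<open>\<bar>b\<^sub>k\<bar>\<close>. Because these coefficients are nonnegative, nothing cancels in the Cauchy product, and the
  left-hand side of Hilbert's inequality is recovered exactly.
\<close>
lemma hardy_imp_hilbert:
  assumes c: "c \<in> X_space" and A: "0 \<le> A" and hardy: "hardy_inequality c A"
  shows "hilbert_inequality c A"
  unfolding hilbert_inequality_iff_triangles
proof (intro ballI allI)
  fix a b N assume ab: "a \<in> l2" "b \<in> l2"
  define \<alpha> \<beta> :: "nat \<Rightarrow> complex" where "\<alpha> n = of_real (cmod (a n))" and "\<beta> n = of_real (cmod (b n))" for n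
  have l2: "\<alpha> \<in> l2" "\<beta> \<in> l2" using ab by (simp_all add: l2_def \<alpha>_def \<beta>_def)
  have norms: "l2_norm \<alpha> = l2_norm a" "l2_norm \<beta> = l2_norm b"
    by (simp_all add: l2_norm_def \<alpha>_def \<beta>_def)
  define g h where "g z = (\<Sum>n. \<alpha> n * z ^ n)" and "h z = (\<Sum>n. \<beta> n * z ^ n)" for z
  have g: "(\<lambda>n. \<alpha> n * z ^ n) sums g z" and h: "(\<lambda>n. \<beta> n * z ^ n) sums h z" if "z \<in> ball 0 1" for z
    unfolding g_def h_def by (rule l2_power_series l2 that)+
  define s where "s n = (\<Sum>k\<le>n. \<alpha> k * \<beta> (n - k))" for n
  have s: "s n = of_real (\<Sum>k\<le>n. cmod (a k) * cmod (b (n - k)))" for n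
    by (simp add: s_def \<alpha>_def \<beta>_def)
  have f: "(\<lambda>n. s n * z ^ n) sums (g z * h z)" if "z \<in> ball 0 1" for z
    unfolding s_def by (rule power_series_mult[of \<alpha> g \<beta> h]) (use g h that in auto)
  have mean: "circle_mean (\<lambda>z. g z * h z) r \<le> l2_norm a * l2_norm b" if r: "r \<in> {0<..<1}" for r
  proof -
    have "continuous_on (ball 0 1) g" "continuous_on (ball 0 1) h"
      using power_series_holomorphic_on_disc[of \<alpha> g] power_series_holomorphic_on_disc[of \<beta> h] g h
      by (auto intro: holomorphic_on_imp_continuous_on)
    moreover have "sphere 0 r \<subseteq> (ball 0 1 :: complex set)" using r by auto
    ultimately have "continuous_on (sphere 0 r) g" "continuous_on (sphere 0 r) h"
      by (blast intro: continuous_on_subset)+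
    then have "circle_mean (\<lambda>z. g z * h z) r
        \<le> sqrt (circle_mean (\<lambda>z. (g z)\<^sup>2) r) * sqrt (circle_mean (\<lambda>z. (h z)\<^sup>2) r)"
      by (rule circle_mean_Cauchy_Schwarz) (use r in simp)
    also have "\<dots> \<le> l2_norm \<alpha> * l2_norm \<beta>"
      using r l2 g h
      by (intro mult_mono circle_mean_square_le_l2_norm l2_norm_nonneg) (auto simp: circle_mean_nonneg)
    finally show ?thesis by (simp add: norms)
  qed
  then have H1: "(\<lambda>z. g z * h z) \<in> H1"
    using power_series_holomorphic_on_disc[of s, OF f] by (auto simp: H1_def intro!: bdd_aboveI2[of _ _ "l2_norm a * l2_norm b"])
  have "H1_norm (\<lambda>z. g z * h z) \<le> l2_norm a * l2_norm b"
    unfolding H1_norm_def by (rule cSUP_least) (use mean in auto)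
  then have le: "A * X_norm c * H1_norm (\<lambda>z. g z * h z) \<le> A * X_norm c * (l2_norm a * l2_norm b)"
    by (intro mult_left_mono mult_nonneg_nonneg A X_norm_nonneg c)
  have H: "summable (\<lambda>n. cmod (s n * c n))"
      "(\<Sum>n. cmod (s n * c n)) \<le> A * X_norm c * H1_norm (\<lambda>z. g z * h z)"
    using hardy[unfolded hardy_inequality_def, rule_format, OF H1 f] by simp_all
  have "(\<Sum>n\<le>N. (\<Sum>k\<le>n. cmod (a k) * cmod (b (n - k))) * cmod (c n)) = (\<Sum>n\<le>N. cmod (s n * c n))"
    unfolding s by (simp add: norm_mult sum_nonneg del: of_real_sum)
  also have "\<dots> \<le> (\<Sum>n. cmod (s n * c n))"
    by (rule sum_le_suminf[OF H(1)]) auto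
  also have "\<dots> \<le> A * X_norm c * l2_norm a * l2_norm b"
    using H(2) le by (simp add: mult.assoc)
  finally show "(\<Sum>n\<le>N. (\<Sum>k\<le>n. cmod (a k) * cmod (b (n - k))) * cmod (c n)) \<le> A * X_norm c * l2_norm a * l2_norm b" .
qed

section \<open>Reflecting the zeros of a polynomial in the unit circle\<close>

text \<open>
  The difference of the squares factors as \<open>(1 - \<bar>z\<bar>\<^sup>2) (1 - \<bar>w\<bar>\<^sup>2)\<close>.
\<close>
lemma disc_reflection_le:
  assumes "cmod z \<le> 1" "cmod w \<le> 1"
  shows "cmod (z - w) \<le> cmod (1 - cnj w * z)"
proof -
  have "(cmod (1 - cnj w * z))\<^sup>2 - (cmod (z - w))\<^sup>2 = (1 - (cmod z)\<^sup>2) * (1 - (cmod w)\<^sup>2)"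
    unfolding cmod_power2 by (simp add: power2_eq_square algebra_simps)
  moreover have "0 \<le> (1 - (cmod z)\<^sup>2) * (1 - (cmod w)\<^sup>2)"
    by (intro mult_nonneg_nonneg) (simp_all add: power_le_one assms)
  ultimately have "(cmod (z - w))\<^sup>2 \<le> (cmod (1 - cnj w * z))\<^sup>2" by linarith
  then show ?thesis by (rule power2_le_imp_le) (rule norm_ge_zero)
qed

lemma circle_reflection_eq:
  assumes "cmod z = 1"
  shows "cmod (1 - cnj w * z) = cmod (z - w)"
proof -
  have z: "z * cnj z = 1" by (simp only: assms power_one of_real_1 flip: complex_norm_square)
  have "1 - cnj w * z = z * cnj (z - w)"
    by (simp only: z complex_cnj_diff right_diff_distrib mult.commute[of "cnj w"])
  then have "cmod (1 - cnj w * z) = cmod z * cmod (cnj (z - w))" by (simp only: norm_mult)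
  then show ?thesis by (simp only: assms complex_mod_cnj mult_1)
qed

text \<open>
  Dividing \<open>p\<close> by its finite Blaschke product yields \<open>q\<close>: each linear factor \<open>z - w\<close> with a zero \<open>w\<close> in
  the disc is replaced by \<open>1 - cnj w * z\<close>, which does not vanish in the disc, has the same modulus on
  the circle, and is at least as large inside. Zeros on the circle are left alone.
\<close>
lemma outer_polynomial:
  fixes p :: "complex poly"
  assumes "p \<noteq> 0"
  shows "\<exists>q. (\<forall>z\<in>ball 0 1. poly q z \<noteq> 0) \<and> (\<forall>z. cmod z = 1 \<longrightarrow> cmod (poly q z) = cmod (poly p z)) \<and>
    (\<forall>z\<in>ball 0 1. cmod (poly p z) \<le> cmod (poly q z))"
  using assms
proof (induction "degree p" arbitrary: p rule: less_induct)
  case less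
  show ?case
  proof (cases "\<exists>w\<in>ball 0 1. poly p w = 0")
    case False
    then show ?thesis by (intro exI[of _ p]) auto
  next
    case True
    then obtain w p' where w: "cmod w < 1" and p: "p = [:- w, 1:] * p'"
      by (auto simp: poly_eq_0_iff_dvd dvd_def)
    with less.prems have p': "p' \<noteq> 0" by auto
    then have "degree p' < degree p" unfolding p by (subst degree_mult_eq) auto
    from less.hyps[OF this p'] obtain q where
      q: "\<forall>z\<in>ball 0 1. poly q z \<noteq> 0" "\<forall>z. cmod z = 1 \<longrightarrow> cmod (poly q z) = cmod (poly p' z)"
        "\<forall>z\<in>ball 0 1. cmod (poly p' z) \<le> cmod (poly q z)"
      by blast
    then have
      q0: "\<And>z. cmod z < 1 \<Longrightarrow> poly q z \<noteq> 0" and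
      q1: "\<And>z. cmod z = 1 \<Longrightarrow> cmod (poly q z) = cmod (poly p' z)" and
      q2: "\<And>z. cmod z < 1 \<Longrightarrow> cmod (poly p' z) \<le> cmod (poly q z)"
      by auto
    \<comment> \<open>the new factor can only vanish where \<open>\<bar>z\<bar> = 1 / \<bar>w\<bar> > 1\<close>\<close>
    have nz: "cnj w * z \<noteq> 1" if "cmod z < 1" for z
    proof
      assume "cnj w * z = 1"
      then have "cmod w * cmod z = 1" by (metis complex_mod_cnj norm_mult norm_one)
      moreover have "cmod w * cmod z < 1 * 1"
        using w that by (intro mult_strict_mono') auto
      ultimately show False by simp
    qed
    let ?q = "[:1, - cnj w:] * q"
    have P: "poly p z = (z - w) * poly p' z" "poly ?q z = (1 - cnj w * z) * poly q z" for z
      by (simp_all add: p algebra_simps)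
    show ?thesis
    proof (intro exI[of _ ?q] conjI ballI allI impI)
      fix z :: complex assume "z \<in> ball 0 1"
      then have z: "cmod z < 1" by simp
      show "poly ?q z \<noteq> 0" unfolding P using q0[OF z] nz[OF z] by simp
      show "cmod (poly p z) \<le> cmod (poly ?q z)"
        unfolding P norm_mult using z w by (intro mult_mono q2 disc_reflection_le) auto
    next
      fix z :: complex assume "cmod z = 1"
      then show "cmod (poly ?q z) = cmod (poly p z)"
        unfolding P norm_mult by (simp add: circle_reflection_eq q1)
    qed
  qed
qed

section \<open>Hilbert's inequality implies Hardy's\<close>

text \<open>
  By Parseval's identity the dilated coefficients of \<open>g\<close> and \<open>h\<close> have \<open>\<ell>\<^sup>2\<close> norm at most \<open>sqrt M\<close>, so
  Hilbert's inequality applies to them. Working on a circle of radius \<open>r < 1\<close> avoids any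
  discussion of boundary values.
\<close>
lemma hilbert_imp_product_bound:
  assumes hilbert: "hilbert_inequality c B" and c: "c \<in> X_space" and B: "0 \<le> B"
    and g: "g holomorphic_on ball 0 1" and h: "h holomorphic_on ball 0 1"
    and f: "\<And>z. z \<in> ball 0 1 \<Longrightarrow> (\<lambda>n. a n * z ^ n) sums (g z * h z)"
    and r: "0 \<le> r" "r < 1"
    and gM: "circle_mean (\<lambda>z. (g z)\<^sup>2) r \<le> M" and hM: "circle_mean (\<lambda>z. (h z)\<^sup>2) r \<le> M"
  shows "(\<Sum>n\<le>N. cmod (a n * c n) * r ^ n) \<le> B * X_norm c * M"
proof -
  define \<gamma> \<eta> where "\<gamma> n = (deriv ^^ n) g 0 / fact n" and "\<eta> n = (deriv ^^ n) h 0 / fact n" for n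
  have g': "(\<lambda>n. \<gamma> n * z ^ n) sums g z" and h': "(\<lambda>n. \<eta> n * z ^ n) sums h z" if "z \<in> ball 0 1" for z
    using holomorphic_power_series[OF g that] holomorphic_power_series[OF h that]
    by (simp_all add: \<gamma>_def \<eta>_def)
  have a: "a = (\<lambda>n. \<Sum>k\<le>n. \<gamma> k * \<eta> (n - k))"
    by (rule power_series_unique[of _ "\<lambda>z. g z * h z"]) (use f power_series_mult[OF g' h'] in auto)
  define \<gamma>' \<eta>' where "\<gamma>' n = \<gamma> n * of_real (r ^ n)" and "\<eta>' n = \<eta> n * of_real (r ^ n)" for n
  have sq: "(cmod (\<gamma>' n))\<^sup>2 = (cmod (\<gamma> n) * r ^ n)\<^sup>2" "(cmod (\<eta>' n))\<^sup>2 = (cmod (\<eta> n) * r ^ n)\<^sup>2" for n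
    using r by (simp_all add: \<gamma>'_def \<eta>'_def norm_mult norm_power)
  note P = parseval_circle[of \<gamma> g r, OF g' r] parseval_circle[of \<eta> h r, OF h' r]
  have l2: "\<gamma>' \<in> l2" "\<eta>' \<in> l2" using P by (auto simp: l2_def sq sums_iff)
  have norms: "l2_norm \<gamma>' \<le> sqrt M" "l2_norm \<eta>' \<le> sqrt M"
    using P gM hM by (simp_all add: l2_norm_def sq sums_iff)
  have "0 \<le> M" using gM circle_mean_nonneg order_trans by blast
  have "cmod (a n * c n) * r ^ n \<le> (\<Sum>k\<le>n. cmod (\<gamma>' k) * cmod (\<eta>' (n - k))) * cmod (c n)" for n
  proof -
    have "a n * of_real (r ^ n) = (\<Sum>k\<le>n. \<gamma>' k * \<eta>' (n - k))"
      unfolding a sum_distrib_right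
    proof (rule sum.cong)
      fix k assume "k \<in> {..n}"
      then have "r ^ n = r ^ k * r ^ (n - k)" by (simp flip: power_add)
      then show "\<gamma> k * \<eta> (n - k) * of_real (r ^ n) = \<gamma>' k * \<eta>' (n - k)"
        by (simp add: \<gamma>'_def \<eta>'_def)
    qed simp
    then have "cmod (a n) * r ^ n = cmod (\<Sum>k\<le>n. \<gamma>' k * \<eta>' (n - k))"
      using r by (metis norm_mult norm_of_real abs_of_nonneg zero_le_power)
    also have "\<dots> \<le> (\<Sum>k\<le>n. cmod (\<gamma>' k) * cmod (\<eta>' (n - k)))"
      by (rule order_trans[OF norm_sum]) (simp add: norm_mult)
    finally have "cmod (a n) * r ^ n * cmod (c n) \<le> (\<Sum>k\<le>n. cmod (\<gamma>' k) * cmod (\<eta>' (n - k))) * cmod (c n)"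
      by (rule mult_right_mono) simp
    then show ?thesis by (simp add: norm_mult mult_ac)
  qed
  then have "(\<Sum>n\<le>N. cmod (a n * c n) * r ^ n)
      \<le> (\<Sum>n\<le>N. (\<Sum>k\<le>n. cmod (\<gamma>' k) * cmod (\<eta>' (n - k))) * cmod (c n))"
    by (rule sum_mono)
  also have "\<dots> \<le> B * X_norm c * l2_norm \<gamma>' * l2_norm \<eta>'"
    using hilbert l2 unfolding hilbert_inequality_iff_triangles by blast
  also have "\<dots> = B * X_norm c * (l2_norm \<gamma>' * l2_norm \<eta>')" by simp
  also have "\<dots> \<le> B * X_norm c * (sqrt M * sqrt M)"
    using \<open>0 \<le> M\<close>
    by (intro mult_left_mono mult_mono norms mult_nonneg_nonneg B X_norm_nonneg c l2_norm_nonneg l2) auto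
  finally show ?thesis using \<open>0 \<le> M\<close> by simp
qed

lemma poly_sums:
  fixes p :: "complex poly"
  shows "(\<lambda>n. coeff p n * z ^ n) sums poly p z"
  unfolding poly_altdef by (rule sums_finite) (auto simp: coeff_eq_0)

text \<open>
  The factorization is \<open>p = s h\<close> with \<open>s\<^sup>2 = q\<close>, where \<open>q\<close> is the outer polynomial belonging to \<open>p\<close>.
  Both squared moduli are at most \<open>\<bar>q\<bar>\<close> in the disc. As \<open>q\<close> may vanish on the unit circle, \<open>s\<close> lives
  only in the open disc; the bound is obtained for radii \<open>r < 1\<close> and \<open>r\<close> then tends to \<open>1\<close>, where
  \<open>q\<close> and \<open>p\<close> have the same mean.
\<close>
lemma hilbert_imp_polynomial_bound:
  assumes hilbert: "hilbert_inequality c B" and c: "c \<in> X_space" and B: "0 \<le> B"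
  shows "(\<Sum>n\<le>N. cmod (coeff p n * c n)) \<le> B * X_norm c * circle_mean (poly p) 1"
proof (cases "p = 0")
  case True
  then show ?thesis by (simp add: B X_norm_nonneg c circle_mean_nonneg)
next
  case False
  then obtain q where nz: "\<forall>z\<in>ball 0 1. poly q z \<noteq> 0"
    and circle: "\<forall>z. cmod z = 1 \<longrightarrow> cmod (poly q z) = cmod (poly p z)"
    and disc: "\<forall>z\<in>ball 0 1. cmod (poly p z) \<le> cmod (poly q z)"
    using outer_polynomial by blast
  obtain s where s: "s holomorphic_on ball 0 1" and sq: "\<And>z. z \<in> ball 0 1 \<Longrightarrow> poly q z = (s z)\<^sup>2"
    by (rule contractible_imp_holomorphic_sqrt[of "poly q" "ball 0 1"])
       (use nz in \<open>auto intro!: holomorphic_intros convex_imp_contractible\<close>)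
  have s0: "s z \<noteq> 0" if "z \<in> ball 0 1" for z using nz sq that by fastforce
  define h where "h z = poly p z / s z" for z
  have h: "h holomorphic_on ball 0 1"
    unfolding h_def using s s0 by (auto intro!: holomorphic_intros)
  have ps: "(\<lambda>n. coeff p n * z ^ n) sums (s z * h z)" if "z \<in> ball 0 1" for z
    using poly_sums[of p z] s0[OF that] by (simp add: h_def)
  have bound: "(\<Sum>n\<le>N. cmod (coeff p n * c n) * r ^ n) \<le> B * X_norm c * circle_mean (poly q) r"
    if r: "r \<in> {0<..<1}" for r
  proof (rule hilbert_imp_product_bound[OF hilbert c B s h ps])
    have sph: "sphere 0 r \<subseteq> (ball 0 1 :: complex set)" using r by auto
    show "0 \<le> r" "r < 1" using r by auto
    show "circle_mean (\<lambda>z. (s z)\<^sup>2) r \<le> circle_mean (poly q) r"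
      by (rule eq_refl, rule circle_mean_cong) (use r sq in auto)
    show "circle_mean (\<lambda>z. (h z)\<^sup>2) r \<le> circle_mean (poly q) r"
    proof (rule circle_mean_mono)
      show "continuous_on (sphere 0 r) (\<lambda>z. (h z)\<^sup>2)"
        using holomorphic_on_imp_continuous_on[OF h] sph
        by (auto intro!: continuous_intros intro: continuous_on_subset)
      show "continuous_on (sphere 0 r) (poly q)" by (intro continuous_intros)
    next
      fix z :: complex assume "cmod z = r"
      then have z: "z \<in> ball 0 1" using r by simp
      have pos: "0 < (cmod (s z))\<^sup>2" using s0[OF z] by simp
      have "(cmod (poly p z))\<^sup>2 \<le> ((cmod (s z))\<^sup>2)\<^sup>2"
        using disc z sq by (intro power_mono) (auto simp: norm_power)
      then show "cmod ((h z)\<^sup>2) \<le> cmod (poly q z)"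
        using pos by (simp add: sq[OF z] h_def norm_power norm_divide power_divide divide_le_eq
            power2_eq_square[of "(cmod (s z))\<^sup>2"])
    qed (use r in simp)
  qed
  have "continuous_on UNIV (circle_mean (poly q))"
    by (intro continuous_on_circle_mean continuous_intros)
  then have "(circle_mean (poly q) \<longlongrightarrow> circle_mean (poly q) 1) (at_left 1)"
    by (auto simp: continuous_on_def intro: tendsto_within_subset)
  then have rhs: "((\<lambda>r. B * X_norm c * circle_mean (poly q) r) \<longlongrightarrow> B * X_norm c * circle_mean (poly q) 1) (at_left 1)"
    by (intro tendsto_intros)
  have lhs: "((\<lambda>r. \<Sum>n\<le>N. cmod (coeff p n * c n) * r ^ n) \<longlongrightarrow> (\<Sum>n\<le>N. cmod (coeff p n * c n) * 1 ^ n)) (at_left 1)"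
    by (intro tendsto_intros)
  have "eventually (\<lambda>r::real. r \<in> {0<..<1}) (at_left 1)"
    by (rule eventually_at_left_real) simp
  then have "(\<Sum>n\<le>N. cmod (coeff p n * c n) * 1 ^ n) \<le> B * X_norm c * circle_mean (poly q) 1"
    by (intro tendsto_le[OF _ rhs lhs]) (auto elim!: eventually_mono intro: bound)
  also have "circle_mean (poly q) 1 = circle_mean (poly p) 1"
    using circle by (intro circle_mean_cong) auto
  finally show ?thesis by simp
qed

text \<open>
  Two limits lead from polynomials to \<open>H\<^sup>1\<close>: the Taylor polynomials of \<open>f (r z)\<close> converge uniformly on
  the unit circle, and the mean of \<open>\<bar>f\<bar>\<close> over the circle of radius \<open>r\<close> is at most \<open>\<parallel>f\<parallel>\<^sub>1\<close> for all \<open>r < 1\<close>.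
\<close>
lemma hilbert_imp_hardy:
  assumes hilbert: "hilbert_inequality c B" and c: "c \<in> X_space" and B: "0 \<le> B"
  shows "hardy_inequality c B"
  unfolding hardy_inequality_def
proof (intro ballI allI impI)
  fix f a assume f: "f \<in> H1" and "\<forall>z\<in>ball 0 1. (\<lambda>n. a n * z ^ n) sums f z"
  then have ps: "(\<lambda>n. a n * z ^ n) sums f z" if "z \<in> ball 0 1" for z using that by blast
  have K: "0 \<le> B * X_norm c" by (intro mult_nonneg_nonneg B X_norm_nonneg c)
  have radius: "(\<Sum>n\<le>N. cmod (a n * c n) * r ^ n) \<le> B * X_norm c * H1_norm f" if r: "r \<in> {0<..<1}" for N r
  proof -
    \<comment> \<open>the Taylor polynomials of \<open>f (r z)\<close>, which share all coefficients up to \<open>N\<close> once \<open>N < L\<close>\<close>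
    define p where "p L = (\<Sum>k<L. monom (a k * of_real r ^ k) k)" for L
    have coeff_p: "coeff (p L) n = (if n < L then a n * of_real r ^ n else 0)" for L n
      by (simp add: p_def coeff_sum)
    have mean_p: "circle_mean (poly (p L)) 1 = circle_mean (\<lambda>z. \<Sum>k<L. a k * z ^ k) r" for L
      by (simp add: circle_mean_def p_def poly_sum poly_monom power_mult_distrib mult_ac)
    have "(\<Sum>n\<le>N. cmod (a n * c n) * r ^ n) \<le> B * X_norm c * circle_mean (\<lambda>z. \<Sum>k<L. a k * z ^ k) r"
      if "N < L" for L
    proof -
      have "(\<Sum>n\<le>N. cmod (a n * c n) * r ^ n) = (\<Sum>n\<le>N. cmod (coeff (p L) n * c n))"
        using that r by (intro sum.cong) (auto simp: coeff_p norm_mult norm_power)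
      then show ?thesis using hilbert_imp_polynomial_bound[OF hilbert c B, of "p L" N] by (simp add: mean_p)
    qed
    moreover have "(\<lambda>L. B * X_norm c * circle_mean (\<lambda>z. \<Sum>k<L. a k * z ^ k) r)
        \<longlonglongrightarrow> B * X_norm c * circle_mean f r"
      using r by (intro tendsto_intros circle_mean_partial_sums ps) auto
    ultimately have "(\<Sum>n\<le>N. cmod (a n * c n) * r ^ n) \<le> B * X_norm c * circle_mean f r"
      by (intro LIMSEQ_le_const) (auto intro!: exI[of _ "Suc N"])
    also have "\<dots> \<le> B * X_norm c * H1_norm f"
      unfolding H1_norm_def using f r by (intro mult_left_mono K cSUP_upper) (auto simp: H1_def)
    finally show ?thesis .
  qed
  have partial: "(\<Sum>n\<le>N. cmod (a n * c n)) \<le> B * X_norm c * H1_norm f" for N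
  proof -
    have "((\<lambda>r. \<Sum>n\<le>N. cmod (a n * c n) * r ^ n) \<longlongrightarrow> (\<Sum>n\<le>N. cmod (a n * c n) * 1 ^ n)) (at_left 1)"
      by (intro tendsto_intros)
    moreover have "eventually (\<lambda>r::real. r \<in> {0<..<1}) (at_left 1)"
      by (rule eventually_at_left_real) simp
    ultimately have "(\<Sum>n\<le>N. cmod (a n * c n) * 1 ^ n) \<le> B * X_norm c * H1_norm f"
      by (intro tendsto_upperbound[where F = "at_left 1"]) (auto elim!: eventually_mono intro: radius)
    then show ?thesis by simp
  qed
  show "summable (\<lambda>n. cmod (a n * c n)) \<and> (\<Sum>n. cmod (a n * c n)) \<le> B * X_norm c * H1_norm f"
  proof
    show s: "summable (\<lambda>n. cmod (a n * c n))"
      by (rule bounded_imp_summable[OF _ partial]) simp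
    show "(\<Sum>n. cmod (a n * c n)) \<le> B * X_norm c * H1_norm f"
      by (rule LIMSEQ_le_const2[OF summable_LIMSEQ'[OF s]]) (use partial in blast)
  qed
qed

section \<open>Least constants\<close>

text \<open>
  Hilbert's inequality is a family of conditions \<open>T \<le> C * Q\<close> with \<open>Q \<ge> 0\<close>, each of which is closed in
  \<open>C\<close>; hence the infimum of the admissible constants is admissible.
\<close>
lemma least_hilbert_constant:
  assumes c: "c \<in> X_space" and B: "0 \<le> B" "hilbert_inequality c B"
  shows "\<exists>K. is_least_constant (hilbert_inequality c) K"
proof -
  define S where "S = {C. 0 \<le> C \<and> hilbert_inequality c C}"
  have S: "S \<noteq> {}" "bdd_below S" using B by (auto simp: S_def intro: bdd_belowI[of _ 0])
  have "hilbert_inequality c (Inf S)"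
    unfolding hilbert_inequality_iff_triangles
  proof (intro ballI allI)
    fix a b N assume ab: "a \<in> l2" "b \<in> l2"
    define Q where "Q = X_norm c * l2_norm a * l2_norm b"
    define T where "T = (\<Sum>n\<le>N. (\<Sum>k\<le>n. cmod (a k) * cmod (b (n - k))) * cmod (c n))"
    have Q: "0 \<le> Q" unfolding Q_def by (intro mult_nonneg_nonneg X_norm_nonneg c l2_norm_nonneg ab)
    have T: "T \<le> C * Q" if "C \<in> S" for C
      using that ab unfolding S_def hilbert_inequality_iff_triangles T_def Q_def by (auto simp: mult.assoc)
    have "T \<le> Inf S * Q"
    proof (cases "Q = 0")
      \<comment> \<open>the condition then reads \<open>T \<le> 0\<close> whatever the constant, and some constant is admissible\<close>
      case True
      then show ?thesis using S T by auto
    next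
      case False
      with Q T have "T / Q \<le> C" if "C \<in> S" for C using that by (simp add: divide_le_eq)
      then have "T / Q \<le> Inf S" by (intro cInf_greatest S)
      then show ?thesis using False Q by (simp add: divide_le_eq)
    qed
    then show "(\<Sum>n\<le>N. (\<Sum>k\<le>n. cmod (a k) * cmod (b (n - k))) * cmod (c n)) \<le> Inf S * X_norm c * l2_norm a * l2_norm b"
      by (simp add: T_def Q_def mult.assoc)
  qed
  moreover have "0 \<le> Inf S" using S by (intro cInf_greatest) (auto simp: S_def)
  moreover have "Inf S \<le> C" if "0 \<le> C" "hilbert_inequality c C" for C
    using that S by (intro cInf_lower) (auto simp: S_def)
  ultimately show ?thesis unfolding is_least_constant_def by blast
qed

theorem theorem3p5:
  fixes c :: "nat \<Rightarrow> complex"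
  assumes "c \<in> X_space"
  shows "((\<exists>A\<ge>0. hardy_inequality c A) \<longleftrightarrow> (\<exists>B\<ge>0. hilbert_inequality c B)) \<and>
    ((\<exists>A\<ge>0. hardy_inequality c A) \<longrightarrow>
      (\<exists>A B. is_least_constant (hardy_inequality c) A \<and>
             is_least_constant (hilbert_inequality c) B \<and> A = B))"
proof -
  have iff: "hardy_inequality c C \<longleftrightarrow> hilbert_inequality c C" if "0 \<le> C" for C
    using hardy_imp_hilbert hilbert_imp_hardy assms that by blast
  then have "is_least_constant (hardy_inequality c) K \<longleftrightarrow> is_least_constant (hilbert_inequality c) K" for K
    unfolding is_least_constant_def by blast
  with iff least_hilbert_constant[OF assms] show ?thesis by blast
qed

end
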